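(* For all integers $n\geq 3$, the rank of the semigroup $\mathcal{OCP}_n$ of order-preserving partial contraction mappings on $[n]=\{1,2,\ldots,n\}$ is $2n$.
   Context: A partial transformation of $[n]=\{1,2,\ldots,n\}$ is a map $\alpha:\mathrm{dom}\,\alpha\to[n]$ with $\mathrm{dom}\,\alpha\subseteq[n]$; its image is $\mathrm{im}\,\alpha$. Maps act on the right, and composition is $x(\alpha\beta)=(x\alpha)\beta$ (defined for those $x\in\mathrm{dom}\,\alpha$ with $x\alpha\in\mathrm{dom}\,\beta$). A partial transformation $\alpha$ is a contraction if $|x\alpha-y\alpha|\leq|x-y|$ for all $x,y\in\mathrm{dom}\,\alpha$; $\mathcal{CP}_n$ is the semigroup of all partial contractions of $[n]$. $\mathcal{OCP}_n=\{\alpha\in\mathcal{CP}_n: x\leq y\Rightarrow x\alpha\leq y\alpha \text{ for all } x,y\in\mathrm{dom}\,\alpha\}$, a semigroup under composition. For a semigroup $S$ and non-empty $A\subseteq S$, $\langle A\rangle$ denotes the set of all finite (non-empty) products of elements of $A$, and $\mathrm{rank}(S)=\min\{|A|: A\subseteq S,\ \langle A\rangle=S\}$. *)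

theory Defs
  imports Main
begin

definition partial_transformations :: "nat \<Rightarrow> (nat \<rightharpoonup> nat) set" where
  "partial_transformations n = {\<alpha>. dom \<alpha> \<subseteq> {1..n} \<and> ran \<alpha> \<subseteq> {1..n}}"

(* Maps act on the right: x(\<alpha>\<beta>) = (x\<alpha>)\<beta>, so the left factor is applied first. *)
definition pt_mult :: "(nat \<rightharpoonup> nat) \<Rightarrow> (nat \<rightharpoonup> nat) \<Rightarrow> (nat \<rightharpoonup> nat)" where
  "pt_mult \<alpha> \<beta> = \<beta> \<circ>\<^sub>m \<alpha>"

(* The distances are taken in int because subtraction on nat truncates. *)
definition is_contraction :: "(nat \<rightharpoonup> nat) \<Rightarrow> bool" where
  "is_contraction \<alpha> \<longleftrightarrow>
     (\<forall>x \<in> dom \<alpha>. \<forall>y \<in> dom \<alpha>.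
        \<bar>int (the (\<alpha> x)) - int (the (\<alpha> y))\<bar> \<le> \<bar>int x - int y\<bar>)"

definition CP :: "nat \<Rightarrow> (nat \<rightharpoonup> nat) set" where
  "CP n = {\<alpha> \<in> partial_transformations n. is_contraction \<alpha>}"

definition OCP :: "nat \<Rightarrow> (nat \<rightharpoonup> nat) set" where
  "OCP n = {\<alpha> \<in> CP n. \<forall>x \<in> dom \<alpha>. \<forall>y \<in> dom \<alpha>. x \<le> y \<longrightarrow> the (\<alpha> x) \<le> the (\<alpha> y)}"

(* All products a * b1 * ... * bk with k >= 0 and all factors in A. *)
definition generated :: "('a \<Rightarrow> 'a \<Rightarrow> 'a) \<Rightarrow> 'a set \<Rightarrow> 'a set" where
  "generated mult A = {foldl mult a bs | a bs. a \<in> A \<and> set bs \<subseteq> A}"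

(* Rank of the semigroup with carrier S and operation mult. Finiteness of A is required
   because card is 0 on infinite sets; the value is meaningful for finitely generated S,
   in particular for finite S. *)
definition semigroup_rank :: "('a \<Rightarrow> 'a \<Rightarrow> 'a) \<Rightarrow> 'a set \<Rightarrow> nat" where
  "semigroup_rank mult S =
     (LEAST k. \<exists>A. A \<subseteq> S \<and> A \<noteq> {} \<and> finite A \<and> generated mult A = S \<and> card A = k)"

lemma pt_mult_assoc: "pt_mult (pt_mult \<alpha> \<beta>) \<gamma> = pt_mult \<alpha> (pt_mult \<beta> \<gamma>)"
  by (rule ext) (simp add: pt_mult_def map_comp_def split: option.split)

lemma OCP_closed:
  assumes "\<alpha> \<in> OCP n" "\<beta> \<in> OCP n"
  shows "pt_mult \<alpha> \<beta> \<in> OCP n"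
proof -
  have D: "\<exists>u v. \<alpha> x = Some u \<and> \<beta> u = Some v \<and> pt_mult \<alpha> \<beta> x = Some v"
    if "x \<in> dom (pt_mult \<alpha> \<beta>)" for x
    using that by (auto simp: pt_mult_def map_comp_def split: option.splits)
  have pt: "pt_mult \<alpha> \<beta> \<in> partial_transformations n"
    using assms
    by (force simp: OCP_def CP_def partial_transformations_def pt_mult_def map_comp_def
        dom_def ran_def split: option.splits)
  have "\<bar>int (the (pt_mult \<alpha> \<beta> x)) - int (the (pt_mult \<alpha> \<beta> y))\<bar> \<le> \<bar>int x - int y\<bar> \<and>
      (x \<le> y \<longrightarrow> the (pt_mult \<alpha> \<beta> x) \<le> the (pt_mult \<alpha> \<beta> y))"
    if xy: "x \<in> dom (pt_mult \<alpha> \<beta>)" "y \<in> dom (pt_mult \<alpha> \<beta>)" for x y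
  proof -
    obtain u v where x: "\<alpha> x = Some u" "\<beta> u = Some v" "pt_mult \<alpha> \<beta> x = Some v"
      using D xy by blast
    obtain u' v' where y: "\<alpha> y = Some u'" "\<beta> u' = Some v'" "pt_mult \<alpha> \<beta> y = Some v'"
      using D xy by blast
    have "\<bar>int u - int u'\<bar> \<le> \<bar>int x - int y\<bar>" "x \<le> y \<longrightarrow> u \<le> u'"
      using assms(1) x(1) y(1) by (force simp: OCP_def CP_def is_contraction_def)+
    moreover have "\<bar>int v - int v'\<bar> \<le> \<bar>int u - int u'\<bar>" "u \<le> u' \<longrightarrow> v \<le> v'"
      using assms(2) x(2) y(2) by (force simp: OCP_def CP_def is_contraction_def)+
    ultimately show ?thesis using x(3) y(3) by auto
  qed
  then show ?thesis using pt by (simp add: OCP_def CP_def is_contraction_def)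
qed

end

theory Submission
  imports Defs
begin

text \<open>
  Both bounds come from the maps that lie directly below the identity.

  Upper bound. An order-preserving partial contraction is a partial identity followed by an
  everywhere defined order-preserving contraction of \<open>[n]\<close>. Partial identities are products of the
  \<open>n\<close> identities with one point removed (\<open>partial_identity_generated\<close>). A total order-preserving
  contraction moves by 0 or 1 at each step, so it is obtained by collapsing adjacent points one pair
  at a time and then shifting the image up (\<open>unit_steps_generated\<close>). This takes the identity, the
  \<open>n - 1\<close> collapses of one adjacent pair and the upward shift that is cut off at \<open>n\<close>. The shift
  itself collapses \<open>n - 1\<close> and \<open>n\<close>, and for \<open>n \<ge> 3\<close> it can replace the collapse of that pair, because
  the collapse of 1 and 2 shifts its image down again. That leaves \<open>n\<close> total generators, hence \<open>2n\<close>
  generators altogether.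

  Lower bound. Call the domain and the kernel of a map its type. There are \<open>2n\<close> types such that a
  product has the type only if one of its two factors has it: a total map that collapses at most one
  adjacent pair, \<open>n\<close> types (\<open>collapse_type_prime\<close>), and an injective map that is undefined at exactly
  one point, again \<open>n\<close> types (\<open>puncture_type_prime\<close>). All of them occur in the semigroup, so every
  generating set contains an element of each. The reason for primality is that a total
  order-preserving contraction without a collapse is the identity (\<open>total_no_collapse_eq_id\<close>).
\<close>

section \<open>Order-preserving partial contractions\<close>

lemma OCP_iff:
  "\<alpha> \<in> OCP n \<longleftrightarrow> dom \<alpha> \<subseteq> {1..n} \<and> ran \<alpha> \<subseteq> {1..n} \<and>
     (\<forall>x y u v. \<alpha> x = Some u \<longrightarrow> \<alpha> y = Some v \<longrightarrow> x \<le> y \<longrightarrow> u \<le> v \<and> v \<le> u + (y - x))"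
  (is "?L \<longleftrightarrow> ?R")
proof
  assume L: ?L
  have "u \<le> v \<and> v \<le> u + (y - x)" if "\<alpha> x = Some u" "\<alpha> y = Some v" "x \<le> y" for x y u v
  proof -
    have xy: "x \<in> dom \<alpha>" "y \<in> dom \<alpha>" using that by auto
    have "\<bar>int (the (\<alpha> x)) - int (the (\<alpha> y))\<bar> \<le> \<bar>int x - int y\<bar>"
      using L xy unfolding OCP_def CP_def is_contraction_def by blast
    moreover have "the (\<alpha> x) \<le> the (\<alpha> y)"
      using L xy that(3) unfolding OCP_def by blast
    ultimately show ?thesis using that by auto
  qed
  then show ?R using L by (auto simp: OCP_def CP_def partial_transformations_def)
next
  assume R: ?R
  have "\<bar>int (the (\<alpha> x)) - int (the (\<alpha> y))\<bar> \<le> \<bar>int x - int y\<bar>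
      \<and> (x \<le> y \<longrightarrow> the (\<alpha> x) \<le> the (\<alpha> y))" if "x \<in> dom \<alpha>" "y \<in> dom \<alpha>" for x y
  proof -
    obtain u v where uv: "\<alpha> x = Some u" "\<alpha> y = Some v" using \<open>x \<in> dom \<alpha>\<close> \<open>y \<in> dom \<alpha>\<close> by blast
    show ?thesis
    proof (cases "x \<le> y")
      case True
      then have "u \<le> v \<and> v \<le> u + (y - x)" using R uv by blast
      with uv True show ?thesis by auto
    next
      case False
      then have "v \<le> u \<and> u \<le> v + (x - y)" using R uv by (meson nat_le_linear)
      with uv False show ?thesis by auto
    qed
  qed
  then show ?L using R by (auto simp: OCP_def CP_def partial_transformations_def is_contraction_def)
qed

lemma OCP_D:
  assumes "\<alpha> \<in> OCP n" "\<alpha> x = Some u" "\<alpha> y = Some v" "x \<le> y"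
  shows "u \<le> v" "v \<le> u + (y - x)"
  using assms unfolding OCP_iff by blast+

lemma OCP_range:
  assumes "\<alpha> \<in> OCP n" "\<alpha> x = Some u"
  shows "x \<in> {1..n}" "u \<in> {1..n}"
proof -
  show "x \<in> {1..n}" using assms unfolding OCP_iff by blast
  show "u \<in> {1..n}" using assms ranI[of \<alpha> x u] unfolding OCP_iff by blast
qed

definition total_map :: "nat \<Rightarrow> (nat \<Rightarrow> nat) \<Rightarrow> (nat \<rightharpoonup> nat)" where
  "total_map n f = (\<lambda>x. if x \<in> {1..n} then Some (f x) else None)"

lemma total_map_mult:
  assumes "\<And>x. x \<in> {1..n} \<Longrightarrow> f x \<in> {1..n}"
  shows "pt_mult (total_map n f) (total_map n g) = total_map n (\<lambda>x. g (f x))"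
  using assms by (auto simp: pt_mult_def map_comp_def total_map_def fun_eq_iff)

lemma total_map_cong:
  "(\<And>x. x \<in> {1..n} \<Longrightarrow> f x = g x) \<Longrightarrow> total_map n f = total_map n g"
  by (auto simp: total_map_def fun_eq_iff)

text \<open>For a map defined on all of \<open>[n]\<close>, being an order-preserving contraction is a condition on
  consecutive points only.\<close>

definition unit_steps :: "nat \<Rightarrow> (nat \<Rightarrow> nat) \<Rightarrow> bool" where
  "unit_steps n f \<longleftrightarrow> (\<forall>x \<in> {1..n}. f x \<in> {1..n}) \<and>
     (\<forall>x \<in> {1..<n}. f x \<le> f (Suc x) \<and> f (Suc x) \<le> Suc (f x))"

lemma unit_steps_bounds:
  assumes "unit_steps n f" "1 \<le> x" "x \<le> y" "y \<le> n"
  shows "f x \<le> f y \<and> f y \<le> f x + (y - x)"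
  using assms(3,4)
proof (induction y rule: dec_induct)
  case (step y)
  then have "f y \<le> f (Suc y)" "f (Suc y) \<le> Suc (f y)"
    using assms(1,2) by (auto simp: unit_steps_def)
  then show ?case using step by auto
qed simp

lemma total_map_in_OCP:
  assumes "unit_steps n f"
  shows "total_map n f \<in> OCP n"
proof -
  have "dom (total_map n f) \<subseteq> {1..n}" by (auto simp: total_map_def split: if_splits)
  moreover have "ran (total_map n f) \<subseteq> {1..n}"
    using assms by (force simp: total_map_def ran_def unit_steps_def split: if_splits)
  moreover have "u \<le> v \<and> v \<le> u + (y - x)"
    if "total_map n f x = Some u" "total_map n f y = Some v" "x \<le> y" for x y u v
    using that unit_steps_bounds[OF assms, of x y] by (auto simp: total_map_def split: if_splits)
  ultimately show ?thesis unfolding OCP_iff by blast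
qed

text \<open>This is the Lipschitz extension of McShane: the extension is the least of the bounds that the
  values \<open>\<alpha> y\<close> impose. The one-sided distance \<open>x - y\<close>, which is 0 for \<open>x \<le> y\<close>, replaces the absolute
  value and makes it order-preserving. The bound \<open>n\<close> keeps it inside \<open>[n]\<close>, and also gives it a value
  when \<open>\<alpha>\<close> is the empty map.\<close>

lemma OCP_extends_to_total:
  assumes \<alpha>: "\<alpha> \<in> OCP n" and "n \<ge> 1"
  obtains f where "unit_steps n f" "\<And>x. x \<in> dom \<alpha> \<Longrightarrow> \<alpha> x = Some (f x)"
proof -
  define g where "g x y = the (\<alpha> y) + (x - y)" for x y
  define f where "f x = Min (insert n (g x ` dom \<alpha>))" for x
  have fin: "finite (dom \<alpha>)" using \<alpha> unfolding OCP_iff by (meson finite_atLeastAtMost finite_subset)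
  have le_n: "f x \<le> n" for x unfolding f_def using fin by simp
  have le_g: "f x \<le> g x y" if "y \<in> dom \<alpha>" for x y unfolding f_def using fin that by simp
  have cases: "f x = n \<or> (\<exists>y \<in> dom \<alpha>. f x = g x y)" for x
  proof -
    have "f x \<in> insert n (g x ` dom \<alpha>)" unfolding f_def by (rule Min_in) (use fin in auto)
    then show ?thesis by auto
  qed
  have pos: "1 \<le> f x" for x
    using cases[of x]
  proof
    assume "\<exists>y \<in> dom \<alpha>. f x = g x y"
    then obtain y v where y: "\<alpha> y = Some v" "f x = g x y" by blast
    then show ?thesis using OCP_range(2)[OF \<alpha> y(1)] by (simp add: g_def)
  qed (use \<open>n \<ge> 1\<close> in simp)
  have up: "f x \<le> f (Suc x)" for x
    using cases[of "Suc x"]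
  proof
    assume "\<exists>y \<in> dom \<alpha>. f (Suc x) = g (Suc x) y"
    then obtain y where "y \<in> dom \<alpha>" "f (Suc x) = g (Suc x) y" by blast
    then show ?thesis using le_g[of y x] by (simp add: g_def)
  qed (use le_n in simp)
  have step: "f (Suc x) \<le> Suc (f x)" for x
    using cases[of x]
  proof
    assume "\<exists>y \<in> dom \<alpha>. f x = g x y"
    then obtain y where "y \<in> dom \<alpha>" "f x = g x y" by blast
    then show ?thesis using le_g[of y "Suc x"] by (simp add: g_def)
  qed (use le_n[of "Suc x"] in simp)
  have "\<alpha> x = Some (f x)" if x: "x \<in> dom \<alpha>" for x
  proof -
    obtain u where u: "\<alpha> x = Some u" using x by blast
    have "f x \<le> u" using le_g[OF x, of x] u by (simp add: g_def)
    moreover have "u \<le> f x"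
      using cases[of x]
    proof
      assume "\<exists>y \<in> dom \<alpha>. f x = g x y"
      then obtain y v where y: "\<alpha> y = Some v" "f x = v + (x - y)" by (auto simp: g_def)
      show ?thesis
      proof (cases "x \<le> y")
        case True
        then show ?thesis using OCP_D(1)[OF \<alpha> u y(1)] y(2) by simp
      next
        case False
        then show ?thesis using OCP_D(2)[OF \<alpha> y(1) u] y(2) by simp
      qed
    qed (use OCP_range(2)[OF \<alpha> u] in simp)
    ultimately show ?thesis using u by simp
  qed
  moreover have "unit_steps n f" using le_n pos up step by (auto simp: unit_steps_def)
  ultimately show thesis using that by blast
qed

section \<open>A generating set with \<open>2n\<close> elements\<close>

lemma generated_base: "a \<in> A \<Longrightarrow> a \<in> generated mult A"
  unfolding generated_def by (force intro: exI[of _ "[]"])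

lemma generated_closed:
  assumes assoc: "\<And>x y z. mult (mult x y) z = mult x (mult y z)"
    and "a \<in> generated mult A" "b \<in> generated mult A"
  shows "mult a b \<in> generated mult A"
proof -
  have foldl_mult: "mult x (foldl mult c ds) = foldl mult (mult x c) ds" for x c ds
    by (induction ds arbitrary: c) (simp_all add: assoc)
  obtain x xs y ys where a: "a = foldl mult x xs" "x \<in> A" "set xs \<subseteq> A"
    and b: "b = foldl mult y ys" "y \<in> A" "set ys \<subseteq> A"
    using assms(2,3) unfolding generated_def by blast
  have "mult a b = foldl mult x (xs @ y # ys)" by (simp add: a(1) b(1) foldl_mult)
  moreover have "set (xs @ y # ys) \<subseteq> A" using a b by simp
  ultimately show ?thesis unfolding generated_def using a(2) by blast
qed

lemmas generated_pt_mult = generated_closed[of pt_mult, OF pt_mult_assoc]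

lemma generated_subset:
  assumes "A \<subseteq> S" "\<And>a b. a \<in> S \<Longrightarrow> b \<in> S \<Longrightarrow> mult a b \<in> S"
  shows "generated mult A \<subseteq> S"
proof -
  have "foldl mult a bs \<in> S" if "a \<in> S" "set bs \<subseteq> A" for a bs
    using that
  proof (induction bs arbitrary: a)
    case (Cons b bs)
    then show ?case using assms by (metis foldl_Cons list.set_intros(1) set_subset_Cons subset_iff)
  qed simp
  then show ?thesis using assms(1) unfolding generated_def by blast
qed

text \<open>The collapse at \<open>i\<close> merges \<open>i\<close> and \<open>i + 1\<close>. For \<open>i = n\<close> there is nothing to merge: this is the
  identity of \<open>[n]\<close>.\<close>

definition collapse :: "nat \<Rightarrow> nat \<Rightarrow> (nat \<rightharpoonup> nat)" where
  "collapse n i = total_map n (\<lambda>x. if x \<le> i then x else x - 1)"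

definition up_shift :: "nat \<Rightarrow> (nat \<rightharpoonup> nat)" where
  "up_shift n = total_map n (\<lambda>x. min n (Suc x))"

definition partial_identity :: "nat set \<Rightarrow> (nat \<rightharpoonup> nat)" where
  "partial_identity X = (\<lambda>x. if x \<in> X then Some x else None)"

definition OCP_generators :: "nat \<Rightarrow> (nat \<rightharpoonup> nat) set" where
  "OCP_generators n = collapse n ` ({1..n} - {n - 1}) \<union> {up_shift n} \<union>
     (\<lambda>i. partial_identity ({1..n} - {i})) ` {1..n}"

lemma collapse_in_OCP:
  assumes "i \<in> {1..n}"
  shows "collapse n i \<in> OCP n"
  unfolding collapse_def by (rule total_map_in_OCP) (use assms in \<open>auto simp: unit_steps_def\<close>)

lemma up_shift_in_OCP: "n \<ge> 1 \<Longrightarrow> up_shift n \<in> OCP n"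
  unfolding up_shift_def by (rule total_map_in_OCP) (auto simp: unit_steps_def)

lemma partial_identity_in_OCP: "X \<subseteq> {1..n} \<Longrightarrow> partial_identity X \<in> OCP n"
  unfolding OCP_iff by (auto simp: partial_identity_def ran_def split: if_splits)

lemma OCP_generators_subset: "n \<ge> 1 \<Longrightarrow> OCP_generators n \<subseteq> OCP n"
  unfolding OCP_generators_def
  using collapse_in_OCP up_shift_in_OCP partial_identity_in_OCP by auto

lemma finite_OCP_generators: "finite (OCP_generators n)"
  unfolding OCP_generators_def by simp

lemma card_OCP_generators:
  assumes "n \<ge> 2"
  shows "card (OCP_generators n) \<le> 2 * n"
proof -
  have "card (collapse n ` ({1..n} - {n - 1})) \<le> n - 1"
    using card_image_le[of "{1..n} - {n - 1}" "collapse n"] assms by (simp add: card_Diff_singleton)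
  moreover have "card ((\<lambda>i. partial_identity ({1..n} - {i})) ` {1..n}) \<le> n"
    using card_image_le[of "{1..n}"] by force
  moreover have "card (OCP_generators n) \<le> card (collapse n ` ({1..n} - {n - 1})) + 1
      + card ((\<lambda>i. partial_identity ({1..n} - {i})) ` {1..n})"
    unfolding OCP_generators_def
    by (intro order.trans[OF card_Un_le] add_mono) auto
  ultimately show ?thesis using assms by linarith
qed

lemma up_shift_mult_collapse_1:
  assumes "n \<ge> 2"
  shows "pt_mult (up_shift n) (collapse n 1) = collapse n (n - 1)"
  unfolding up_shift_def collapse_def
  by (subst total_map_mult) (use assms in \<open>auto intro!: total_map_cong\<close>)

text \<open>For \<open>n = 2\<close> the collapse at 1 would be the omitted generator itself.\<close>

lemma collapse_generated:
  assumes "n \<ge> 3" "i \<in> {1..n}"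
  shows "collapse n i \<in> generated pt_mult (OCP_generators n)"
proof (cases "i = n - 1")
  case True
  have "up_shift n \<in> OCP_generators n" "collapse n 1 \<in> OCP_generators n"
    unfolding OCP_generators_def using assms by auto
  then have "pt_mult (up_shift n) (collapse n 1) \<in> generated pt_mult (OCP_generators n)"
    by (intro generated_pt_mult generated_base)
  then show ?thesis using True assms up_shift_mult_collapse_1[of n] by simp
next
  case False
  then have "collapse n i \<in> OCP_generators n" unfolding OCP_generators_def using assms by auto
  then show ?thesis by (rule generated_base)
qed

lemma unit_steps_collapse_exists:
  assumes "unit_steps n f" "n \<ge> 1" "f n < f 1 + (n - 1)"
  obtains z where "z \<in> {1..<n}" "f (Suc z) = f z"
proof -
  have "\<exists>z \<in> {1..<n}. f (Suc z) = f z"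
  proof (rule ccontr)
    assume no: "\<not> ?thesis"
    have "x \<le> n \<Longrightarrow> f x = f 1 + (x - 1)" if "1 \<le> x" for x
      using that
    proof (induction x rule: dec_induct)
      case (step x)
      then have "f (Suc x) = Suc (f x)"
        using no assms(1) by (force simp: unit_steps_def)
      then show ?case using step by simp
    qed simp
    from this[of n] show False using assms(2,3) by simp
  qed
  then show thesis using that by blast
qed

text \<open>Split off a collapse at a point \<open>z\<close> where \<open>f\<close> stands still. The collapse leaves the argument \<open>n\<close>
  free, and the remaining factor uses it for the new value \<open>f n + 1\<close>. So the last value grows, until
  it reaches \<open>n\<close> and the map is the identity.\<close>

lemma unit_steps_generated_from_1:
  assumes n: "n \<ge> 3" and "unit_steps n f" "f 1 = 1"
  shows "total_map n f \<in> generated pt_mult (OCP_generators n)"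
  using assms(2,3)
proof (induction "n - f n" arbitrary: f rule: less_induct)
  case less
  have rng: "f x \<in> {1..n}" if "x \<in> {1..n}" for x
    using less.prems that by (auto simp: unit_steps_def)
  have mono: "f x \<le> f (Suc x)" "f (Suc x) \<le> Suc (f x)" if "x \<in> {1..<n}" for x
    using less.prems that by (auto simp: unit_steps_def)
  show ?case
  proof (cases "f n = n")
    case True
    have "f x = x" if "x \<in> {1..n}" for x
      using unit_steps_bounds[OF less.prems(1), of 1 x] unit_steps_bounds[OF less.prems(1), of x n]
        that True less.prems(2) by auto
    then have "total_map n f = collapse n n"
      unfolding collapse_def by (intro total_map_cong) auto
    then show ?thesis using collapse_generated[OF n, of n] n by simp
  next
    case False
    then have fn: "f n < n" using rng[of n] n by force
    then obtain z where z: "z \<in> {1..<n}" "f (Suc z) = f z"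
      using unit_steps_collapse_exists[OF less.prems(1)] less.prems(2) n by force
    define h where "h y = (if y \<le> z then f y else if y < n then f (Suc y) else Suc (f n))" for y
    have "unit_steps n h"
      unfolding unit_steps_def
    proof (intro conjI ballI)
      fix x assume x: "x \<in> {1..n}"
      show "h x \<in> {1..n}" using rng[of x] rng[of "Suc x"] x fn z(1) unfolding h_def by auto
    next
      fix x assume x: "x \<in> {1..<n}"
      consider "Suc x \<le> z" | "x = z" "Suc x < n" | "x = z" "Suc x = n"
        | "z < x" "Suc x < n" | "z < x" "Suc x = n"
        using x by fastforce
      then have "h x \<le> h (Suc x) \<and> h (Suc x) \<le> Suc (h x)"
      proof cases
        case 1 then show ?thesis using mono[OF x] by (simp add: h_def)
      next
        case 2 then show ?thesis using mono[of "Suc x"] z x by (simp add: h_def)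
      next
        case 3 then show ?thesis using z by (auto simp: h_def)
      next
        case 4 then show ?thesis using mono[of "Suc x"] x by (simp add: h_def)
      next
        case 5 then show ?thesis by (auto simp: h_def)
      qed
      then show "h x \<le> h (Suc x)" "h (Suc x) \<le> Suc (h x)" by blast+
    qed
    moreover have "h 1 = 1" using z(1) less.prems(2) by (simp add: h_def)
    moreover have "n - h n < n - f n" using fn z(1) by (simp add: h_def)
    ultimately have "total_map n h \<in> generated pt_mult (OCP_generators n)"
      using less.hyps by blast
    then have "pt_mult (collapse n z) (total_map n h) \<in> generated pt_mult (OCP_generators n)"
      using collapse_generated[OF n, of z] z(1) by (intro generated_pt_mult) auto
    moreover have "pt_mult (collapse n z) (total_map n h) = total_map n f"
    proof -
      have "h (if x \<le> z then x else x - 1) = f x" if "x \<in> {1..n}" for x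
      proof -
        consider "x \<le> z" | "x = Suc z" | "Suc z < x" by linarith
        then show ?thesis using that z by cases (auto simp: h_def)
      qed
      then show ?thesis
        unfolding collapse_def using z(1) by (subst total_map_mult) (auto intro!: total_map_cong)
    qed
    ultimately show ?thesis by simp
  qed
qed

text \<open>A map with \<open>f 1 > 1\<close> is \<open>f - 1\<close> followed by the upward shift, whose cut-off at \<open>n\<close> has no effect
  on values below \<open>n\<close>. This reduces to \<open>f 1 = 1\<close>.\<close>

lemma unit_steps_generated:
  assumes n: "n \<ge> 3" and "unit_steps n f"
  shows "total_map n f \<in> generated pt_mult (OCP_generators n)"
  using assms(2)
proof (induction "f 1" arbitrary: f rule: less_induct)
  case less
  show ?case
  proof (cases "f 1 \<le> 1")
    case True
    moreover have "1 \<le> f 1" using less.prems n by (auto simp: unit_steps_def)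
    ultimately show ?thesis using unit_steps_generated_from_1[OF n less.prems] by simp
  next
    case False
    have rng: "1 < f x" "f x \<le> n" if "x \<in> {1..n}" for x
      using unit_steps_bounds[OF less.prems, of 1 x] False that less.prems
      by (auto simp: unit_steps_def)
    define h where "h x = f x - 1" for x
    have "unit_steps n h"
      unfolding unit_steps_def
    proof (intro conjI ballI)
      fix x assume x: "x \<in> {1..n}"
      show "h x \<in> {1..n}" using rng[OF x] unfolding h_def by auto
    next
      fix x assume x: "x \<in> {1..<n}"
      have "f x \<le> f (Suc x)" "f (Suc x) \<le> Suc (f x)"
        using x less.prems by (auto simp: unit_steps_def)
      then show "h x \<le> h (Suc x)" "h (Suc x) \<le> Suc (h x)" unfolding h_def by auto
    qed
    moreover have "h 1 < f 1" using False by (simp add: h_def)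
    ultimately have "total_map n h \<in> generated pt_mult (OCP_generators n)"
      using less.hyps by blast
    then have "pt_mult (total_map n h) (up_shift n) \<in> generated pt_mult (OCP_generators n)"
      by (intro generated_pt_mult generated_base[of "up_shift n"]) (simp_all add: OCP_generators_def)
    moreover have "pt_mult (total_map n h) (up_shift n) = total_map n f"
    proof -
      have "h x \<in> {1..n} \<and> min n (Suc (h x)) = f x" if "x \<in> {1..n}" for x
        using rng[OF that] unfolding h_def by auto
      then show ?thesis
        unfolding up_shift_def by (subst total_map_mult) (auto intro!: total_map_cong)
    qed
    ultimately show ?thesis by simp
  qed
qed

lemma partial_identity_generated:
  assumes n: "n \<ge> 3" and "finite Y" "Y \<subseteq> {1..n}"
  shows "partial_identity ({1..n} - Y) \<in> generated pt_mult (OCP_generators n)"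
  using assms(2,3)
proof (induction Y rule: finite_induct)
  case empty
  have "partial_identity ({1..n} - {}) = collapse n n"
    by (auto simp: partial_identity_def collapse_def total_map_def)
  then show ?case using collapse_generated[OF n, of n] n by simp
next
  case (insert i Y)
  have "partial_identity ({1..n} - {i}) \<in> OCP_generators n"
    using insert.prems unfolding OCP_generators_def by auto
  then have "pt_mult (partial_identity ({1..n} - Y)) (partial_identity ({1..n} - {i}))
      \<in> generated pt_mult (OCP_generators n)"
    using insert by (intro generated_pt_mult generated_base[of "partial_identity ({1..n} - {i})"]) auto
  moreover have "pt_mult (partial_identity ({1..n} - Y)) (partial_identity ({1..n} - {i}))
      = partial_identity ({1..n} - insert i Y)"
    by (auto simp: pt_mult_def partial_identity_def map_comp_def fun_eq_iff)
  ultimately show ?case by simp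
qed

lemma generated_OCP_generators:
  assumes n: "n \<ge> 3"
  shows "generated pt_mult (OCP_generators n) = OCP n"
proof
  show "generated pt_mult (OCP_generators n) \<subseteq> OCP n"
    using n by (intro generated_subset OCP_generators_subset OCP_closed) auto
  show "OCP n \<subseteq> generated pt_mult (OCP_generators n)"
  proof
    fix \<alpha> assume \<alpha>: "\<alpha> \<in> OCP n"
    then obtain f where f: "unit_steps n f" "\<And>x. x \<in> dom \<alpha> \<Longrightarrow> \<alpha> x = Some (f x)"
      using OCP_extends_to_total n by (metis le_trans one_le_numeral)
    have dom: "dom \<alpha> \<subseteq> {1..n}" using \<alpha> unfolding OCP_iff by blast
    then have "{1..n} - ({1..n} - dom \<alpha>) = dom \<alpha>" by blast
    then have "partial_identity (dom \<alpha>) \<in> generated pt_mult (OCP_generators n)"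
      using partial_identity_generated[OF n, of "{1..n} - dom \<alpha>"] by simp
    then have "pt_mult (partial_identity (dom \<alpha>)) (total_map n f)
        \<in> generated pt_mult (OCP_generators n)"
      using unit_steps_generated[OF n f(1)] by (rule generated_pt_mult)
    moreover have "pt_mult (partial_identity (dom \<alpha>)) (total_map n f) = \<alpha>"
    proof
      fix x
      show "pt_mult (partial_identity (dom \<alpha>)) (total_map n f) x = \<alpha> x"
      proof (cases "x \<in> dom \<alpha>")
        case True
        then show ?thesis
          using f(2)[OF True] dom
          by (auto simp: pt_mult_def partial_identity_def map_comp_def total_map_def)
      next
        case False
        then show ?thesis
          by (simp add: pt_mult_def partial_identity_def map_comp_def domIff)
      qed
    qed
    ultimately show "\<alpha> \<in> generated pt_mult (OCP_generators n)" by simp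
  qed
qed

section \<open>Types that every generating set must contain\<close>

text \<open>A type is a domain together with a kernel. For total order-preserving maps the kernel is
  determined by the adjacent pairs that are merged. As for the collapses themselves, \<open>i = n\<close> stands
  for the trivial kernel.\<close>

definition collapse_type :: "nat \<Rightarrow> nat \<Rightarrow> (nat \<rightharpoonup> nat) set" where
  "collapse_type n i = {a. dom a = {1..n} \<and> (\<forall>j \<in> {1..<n}. a j = a (Suc j) \<longleftrightarrow> j = i)}"

definition puncture_type :: "nat \<Rightarrow> nat \<Rightarrow> (nat \<rightharpoonup> nat) set" where
  "puncture_type n i = {a. dom a = {1..n} - {i} \<and> inj_on a (dom a)}"

text \<open>Primality says that the complement of \<open>P\<close> in \<open>S\<close> is closed under products, so a set of
  generators that avoids \<open>P\<close> generates nothing in \<open>P\<close>.\<close>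

lemma generated_prime:
  assumes t: "t \<in> generated mult A" "t \<in> P" and "A \<subseteq> S"
    and closed: "\<And>a b. a \<in> S \<Longrightarrow> b \<in> S \<Longrightarrow> mult a b \<in> S"
    and prime: "\<And>a b. a \<in> S \<Longrightarrow> b \<in> S \<Longrightarrow> mult a b \<in> P \<Longrightarrow> a \<in> P \<or> b \<in> P"
  shows "A \<inter> P \<noteq> {}"
proof -
  have "mult a b \<in> S - P" if "a \<in> S - P" "b \<in> S - P" for a b
    using closed prime that by blast
  then have "generated mult A \<subseteq> S - P" if "A \<inter> P = {}"
    by (intro generated_subset) (use that \<open>A \<subseteq> S\<close> in blast)+
  then show ?thesis using t by blast
qed

text \<open>Without a collapse each of the \<open>n - 1\<close> steps raises the value by exactly 1, and only the
  identity has room for that in \<open>[n]\<close>.\<close>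

lemma total_no_collapse_eq_id:
  assumes a: "a \<in> OCP n" and dom: "dom a = {1..n}"
    and no: "\<And>j. j \<in> {1..<n} \<Longrightarrow> a j \<noteq> a (Suc j)"
  shows "a = partial_identity {1..n}"
proof -
  have av: "a x = Some (the (a x))" if "x \<in> {1..n}" for x
    using that dom by (metis domD option.sel)
  have rng: "the (a x) \<in> {1..n}" if "x \<in> {1..n}" for x using OCP_range(2)[OF a av[OF that]] .
  have us: "unit_steps n (\<lambda>x. the (a x))"
    unfolding unit_steps_def
  proof (intro conjI ballI)
    fix x assume x: "x \<in> {1..<n}"
    then show "the (a x) \<le> the (a (Suc x))" "the (a (Suc x)) \<le> Suc (the (a x))"
      using OCP_D[OF a av[of x] av[of "Suc x"]] by auto
  qed (use rng in blast)
  have id: "the (a x) = x" if x: "x \<in> {1..n}" for x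
  proof -
    have "the (a n) \<ge> the (a 1) + (n - 1)"
    proof (rule ccontr)
      assume "\<not> ?thesis"
      then obtain z where "z \<in> {1..<n}" "the (a (Suc z)) = the (a z)"
        using unit_steps_collapse_exists[OF us] x by (metis atLeastAtMost_iff le_trans not_le)
      then show False using no[of z] av[of z] av[of "Suc z"] by simp
    qed
    then show ?thesis
      using unit_steps_bounds[OF us, of 1 x] unit_steps_bounds[OF us, of x n]
        rng[of 1] rng[of n] x by auto
  qed
  show ?thesis
  proof
    fix x show "a x = partial_identity {1..n} x"
      using dom av[of x] id[of x] by (cases "x \<in> {1..n}") (auto simp: partial_identity_def)
  qed
qed

lemma pt_mult_id_left:
  assumes "b \<in> OCP n"
  shows "pt_mult (partial_identity {1..n}) b = b"
proof
  fix x
  show "pt_mult (partial_identity {1..n}) b x = b x"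
    using OCP_range(1)[OF assms, of x]
    by (cases "b x") (auto simp: pt_mult_def partial_identity_def map_comp_def)
qed

lemma dom_pt_mult: "dom (pt_mult a b) \<subseteq> dom a"
  by (auto simp: pt_mult_def map_comp_def split: option.splits)

lemma pt_mult_eqI: "a x = a y \<Longrightarrow> pt_mult a b x = pt_mult a b y"
  by (simp add: pt_mult_def map_comp_def)

text \<open>The left factor is total and merges no pair that the product keeps apart. If it merges no pair
  at all it is the identity, and the product is the right factor.\<close>

lemma collapse_type_prime:
  assumes a: "a \<in> OCP n" and b: "b \<in> OCP n" and ab: "pt_mult a b \<in> collapse_type n i"
  shows "a \<in> collapse_type n i \<or> b \<in> collapse_type n i"
proof -
  have dom: "dom a = {1..n}"
    using ab dom_pt_mult[of a b] a unfolding collapse_type_def OCP_iff by auto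
  have sub: "j = i" if "j \<in> {1..<n}" "a j = a (Suc j)" for j
    using ab that pt_mult_eqI[of a j "Suc j" b] unfolding collapse_type_def by auto
  show ?thesis
  proof (cases "\<exists>j \<in> {1..<n}. a j = a (Suc j)")
    case True
    then have "a j = a (Suc j) \<longleftrightarrow> j = i" if "j \<in> {1..<n}" for j using sub that by blast
    then have "a \<in> collapse_type n i" using dom unfolding collapse_type_def by blast
    then show ?thesis ..
  next
    case False
    then have "a = partial_identity {1..n}" using total_no_collapse_eq_id[OF a dom] by blast
    then show ?thesis using ab pt_mult_id_left[OF b] by simp
  qed
qed

text \<open>If the left factor is undefined at \<open>i\<close>, it has the type itself. Otherwise it is total. It cannot
  merge two points other than \<open>i\<close>, where the product is injective, and it cannot merge \<open>i\<close> with a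
  neighbour, where the product is defined, since the product would then be defined at \<open>i\<close> too. So it
  is the identity.\<close>

lemma puncture_type_prime:
  assumes a: "a \<in> OCP n" and b: "b \<in> OCP n" and ab: "pt_mult a b \<in> puncture_type n i"
  shows "a \<in> puncture_type n i \<or> b \<in> puncture_type n i"
proof -
  have domab: "dom (pt_mult a b) = {1..n} - {i}" and inj: "inj_on (pt_mult a b) ({1..n} - {i})"
    using ab unfolding puncture_type_def by auto
  have doma: "{1..n} - {i} \<subseteq> dom a" "dom a \<subseteq> {1..n}"
    using domab dom_pt_mult[of a b] a unfolding OCP_iff by auto
  have apart: "a x \<noteq> a y" if "x \<in> {1..n} - {i}" "y \<in> {1..n}" "x \<noteq> y" for x y
  proof
    assume "a x = a y"
    then have eq: "pt_mult a b x = pt_mult a b y" by (rule pt_mult_eqI)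
    then have "y \<in> dom (pt_mult a b)" using that(1) domab by (metis domIff)
    then have "y \<in> {1..n} - {i}" using domab by simp
    then show False using inj_onD[OF inj eq] that by blast
  qed
  show ?thesis
  proof (cases "i \<in> dom a")
    case False
    then have "dom a = {1..n} - {i}" using doma by blast
    moreover have "inj_on a ({1..n} - {i})" by (rule inj_onI) (use apart in blast)
    ultimately show ?thesis unfolding puncture_type_def by simp
  next
    case True
    then have dom: "dom a = {1..n}" using doma by blast
    have "a j \<noteq> a (Suc j)" if "j \<in> {1..<n}" for j
      using apart[of j "Suc j"] apart[of "Suc j" j] that by (cases "j = i") auto
    then have "a = partial_identity {1..n}" using total_no_collapse_eq_id[OF a dom] by blast
    then show ?thesis using ab pt_mult_id_left[OF b] by simp
  qed
qed

lemma collapse_has_type: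
  assumes "i \<in> {1..n}"
  shows "collapse n i \<in> collapse_type n i"
proof -
  have "collapse n i j = collapse n i (Suc j) \<longleftrightarrow> j = i" if "j \<in> {1..<n}" for j
    using that by (auto simp: collapse_def total_map_def)
  moreover have "dom (collapse n i) = {1..n}" by (auto simp: collapse_def total_map_def split: if_splits)
  ultimately show ?thesis unfolding collapse_type_def by blast
qed

lemma partial_identity_has_type: "partial_identity ({1..n} - {i}) \<in> puncture_type n i"
  by (auto simp: puncture_type_def partial_identity_def inj_on_def split: if_splits)

lemma collapse_type_unique:
  assumes "a \<in> collapse_type n i" "a \<in> collapse_type n j" "i \<in> {1..n}" "j \<in> {1..n}"
  shows "i = j"
proof (cases "i < n")
  case True
  then show ?thesis using assms unfolding collapse_type_def by auto
next
  case False
  then have "\<not> j < n \<or> j = i" using assms unfolding collapse_type_def by auto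
  then show ?thesis using False assms by auto
qed

lemma puncture_type_unique:
  assumes "a \<in> puncture_type n i" "a \<in> puncture_type n j" "i \<in> {1..n}"
  shows "i = j"
  using assms unfolding puncture_type_def by blast

lemma card_generating_set_ge:
  assumes A: "A \<subseteq> OCP n" "finite A" and gen: "generated pt_mult A = OCP n"
  shows "2 * n \<le> card A"
proof -
  have "\<exists>a. a \<in> A \<inter> collapse_type n i" if i: "i \<in> {1..n}" for i
    using generated_prime[of "collapse n i" pt_mult A "collapse_type n i" "OCP n"]
      collapse_in_OCP[OF i] collapse_has_type[OF i] A(1) gen OCP_closed collapse_type_prime
    by blast
  then obtain c where c: "\<And>i. i \<in> {1..n} \<Longrightarrow> c i \<in> A \<inter> collapse_type n i" by metis
  have "\<exists>a. a \<in> A \<inter> puncture_type n i" for i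
    using generated_prime[of "partial_identity ({1..n} - {i})" pt_mult A "puncture_type n i" "OCP n"]
      partial_identity_in_OCP[of "{1..n} - {i}" n] partial_identity_has_type[of n i]
      A(1) gen OCP_closed puncture_type_prime
    by blast
  then obtain p where p: "\<And>i. p i \<in> A \<inter> puncture_type n i" by metis
  have "inj_on c {1..n}"
    by (rule inj_onI) (metis IntD2 c collapse_type_unique)
  moreover have "inj_on p {1..n}"
    by (rule inj_onI) (metis IntD2 p puncture_type_unique)
  moreover have "c ` {1..n} \<inter> p ` {1..n} = {}"
  proof -
    have "c i \<noteq> p j" if ij: "i \<in> {1..n}" "j \<in> {1..n}" for i j
    proof -
      have "dom (c i) = {1..n}" "dom (p j) = {1..n} - {j}"
        using c[OF ij(1)] p[of j] unfolding collapse_type_def puncture_type_def by auto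
      moreover have "j \<in> {1..n}" "j \<notin> {1..n} - {j}" using ij(2) by auto
      ultimately show ?thesis by metis
    qed
    then show ?thesis by blast
  qed
  ultimately have "card (c ` {1..n} \<union> p ` {1..n}) = 2 * n"
    by (simp add: card_Un_disjoint card_image)
  moreover have "c ` {1..n} \<union> p ` {1..n} \<subseteq> A" using c p by blast
  ultimately show ?thesis using card_mono[OF A(2)] by metis
qed

section \<open>The rank\<close>

theorem theorem3p6:
  fixes n :: nat
  assumes "n \<ge> 3"
  shows "semigroup_rank pt_mult (OCP n) = 2 * n"
proof -
  have gens: "OCP_generators n \<subseteq> OCP n" "finite (OCP_generators n)"
    "generated pt_mult (OCP_generators n) = OCP n"
    using assms OCP_generators_subset finite_OCP_generators generated_OCP_generators by auto
  have "card (OCP_generators n) = 2 * n"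
    using card_generating_set_ge[OF gens] card_OCP_generators[of n] assms by simp
  moreover have "OCP_generators n \<noteq> {}" unfolding OCP_generators_def by simp
  ultimately show ?thesis
    unfolding semigroup_rank_def
    using gens card_generating_set_ge by (intro Least_equality) blast+
qed

end
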